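(* For $|z|\le1$ and for any $f$ such that $(1-\mathcal L_0)f\in\mathcal F_\theta$ we have $$(1-\mathcal M_z)(1-z\mathcal L_0)f=(1-z\mathcal L)f .$$
   Context: Shift and potential. $\Omega=\{0,1\}^{\{0,1,2,\dots\}}$, $T$ is the left shift, $0^\infty=(000\dots)$, $\tau(\omega)=1+\inf\{i\ge 0:\omega_i=1\}$ (with $\inf\emptyset=\infty$), $A_k=\{\omega:\tau(\omega)=k\}$ for $k\ge1$. Let $\Omega_*$ be the set of $\omega\in\Omega$ with infinitely many $1$'s. For $\omega\in\Omega_*$ the times between passages are $\sigma_k(\omega)=\tau\big((T^\tau)^k\omega\big)$, $k\ge 0$, where $T^\tau\omega=T^{\tau(\omega)}\omega$. A potential $V:\Omega\to\mathbb R$ is given, with induced version $W(\omega)=\sum_{k=0}^{\tau(\omega)-1}V(T^k\omega)$, satisfying: (1) $V$ is continuous, $-C_1\le V\le 0$ for some constant $C_1>0$, and $V(0^\infty)=0$; (2) $\sum_{n\ge1}\exp(\sup_{A_n}W)<C_2$ for some constant $C_2>0$; (3) for some $0<\theta<1$ and $C_3>0$, for all $n\ge1$, $\mathrm{Var}_nW\le C_3\theta^n$, where $\mathrm{Var}_nW=\sup\{|W(\omega)-W(\omega')|:\inf\{k\ge0:\sigma_k(\omega)\ne\sigma_k(\omega')\}=n\}$; (4) the limit $\lim_n\frac1n\log\sum_{\omega_0,\dots,\omega_{n-1}}\exp\big(\sup_{\omega'\in\Omega}\sum_{i=0}^{n-1}V(\omega_i\dots\omega_{n-1}\omega')\big)$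 exists and equals $0$. Operators (acting on functions on $\Omega_*$). $\varphi=e^V$, $\psi=e^W$; $(\mathcal L_0f)(\omega)=\varphi(0\omega)f(0\omega)$, $(\mathcal L_1f)(\omega)=\varphi(1\omega)f(1\omega)$, $\mathcal L=\mathcal L_0+\mathcal L_1$, the transfer operator of $(T,\varphi)$. $\mathcal F_\theta$ is the Banach space of bounded complex functions on $\Omega_*$ which are Lipschitz for $d_\theta(\omega,\omega')=\theta^{\inf\{j\ge0:\sigma_j(\omega)\neq\sigma_j(\omega')\}}$, normed by sup norm plus least Lipschitz constant. For $|z|\le1$, $(\mathcal M_zf)(\omega)=\sum_{k\ge1}z^k\psi(0^{k-1}1\omega)f(0^{k-1}1\omega)=\sum_{k\ge1}z^k(\mathcal L_1\mathcal L_0^{k-1}f)(\omega)$.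
   Formalization: For |z|=1 it is additionally assumed that (L_0^n f)(ω) → 0 for every ω in Ω_*; without this the claim fails, e.g. at z=1 for f=1/ψ, where (1-L_0)f=0 but (1-L)f=-1. Nothing is added for |z|<1. *)

theory Defs
  imports "HOL-Analysis.Analysis" "HOL-Library.Extended_Nat"
begin

text \<open>The symbols 0 and 1 are False and True; the topology on sequences is the product
  topology of the discrete space bool.\<close>

type_synonym seq = "nat \<Rightarrow> bool"

definition shift :: "seq \<Rightarrow> seq" where
  "shift \<omega> = (\<lambda>i. \<omega> (Suc i))"

definition prefix :: "bool \<Rightarrow> seq \<Rightarrow> seq" where
  "prefix b \<omega> = case_nat b \<omega>"

definition tau :: "seq \<Rightarrow> enat" where
  "tau \<omega> = 1 + (INF i\<in>{i. \<omega> i}. enat i)"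

definition A :: "nat \<Rightarrow> seq set" where
  "A k = {\<omega>. tau \<omega> = enat k}"

definition Omega_star :: "seq set" where
  "Omega_star = {\<omega>. infinite {i. \<omega> i}}"

text \<open>Only meaningful where tau is finite, in particular on Omega_star, which it preserves.\<close>

definition T_tau :: "seq \<Rightarrow> seq" where
  "T_tau \<omega> = (shift ^^ the_enat (tau \<omega>)) \<omega>"

definition sigma :: "nat \<Rightarrow> seq \<Rightarrow> enat" where
  "sigma k \<omega> = tau ((T_tau ^^ k) \<omega>)"

definition separation :: "seq \<Rightarrow> seq \<Rightarrow> enat" where
  "separation \<omega> \<omega>' = (INF k\<in>{k. sigma k \<omega> \<noteq> sigma k \<omega>'}. enat k)"

text \<open>At the zero sequence the index set is infinite and the sum is 0 by convention; this is the
  right value because admissible potentials vanish there.\<close>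

definition W :: "(seq \<Rightarrow> real) \<Rightarrow> seq \<Rightarrow> real" where
  "W V \<omega> = (\<Sum>k | enat k < tau \<omega>. V ((shift ^^ k) \<omega>))"

text \<open>The supremum is taken in the extended reals, so that a finite bound on it has content.\<close>

definition Var :: "nat \<Rightarrow> (seq \<Rightarrow> real) \<Rightarrow> ereal" where
  "Var n w = (SUP (\<omega>, \<omega>') \<in> {(\<omega>, \<omega>'). \<omega> \<in> Omega_star \<and> \<omega>' \<in> Omega_star \<and>
      separation \<omega> \<omega>' = enat n}. ereal \<bar>w \<omega> - w \<omega>'\<bar>)"

definition admissible_potential ::
    "(seq \<Rightarrow> real) \<Rightarrow> real \<Rightarrow> real \<Rightarrow> real \<Rightarrow> real \<Rightarrow> bool" where
  "admissible_potential V C1 C2 C3 \<theta> \<longleftrightarrow>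
     C1 > 0 \<and> C2 > 0 \<and> C3 > 0 \<and> 0 < \<theta> \<and> \<theta> < 1 \<and>
     continuous_on UNIV V \<and> (\<forall>\<omega>. - C1 \<le> V \<omega> \<and> V \<omega> \<le> 0) \<and> V (\<lambda>_. False) = 0 \<and>
     summable (\<lambda>n. exp (SUP \<omega>\<in>A (Suc n). W V \<omega>)) \<and>
     (\<Sum>n. exp (SUP \<omega>\<in>A (Suc n). W V \<omega>)) < C2 \<and>
     (\<forall>n\<ge>1. Var n (W V) \<le> ereal (C3 * \<theta> ^ n)) \<and>
     (\<lambda>n. (1 / real n) * ln (\<Sum>u | length u = n.
         exp (SUP \<omega>'. \<Sum>i<n. V (foldr prefix (drop i u) \<omega>')))) \<longlonglongrightarrow> 0"

text \<open>Functions on Omega_star are total functions considered on Omega_star only: all operators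
  below compute values on Omega_star from values on Omega_star.\<close>

definition d_theta :: "real \<Rightarrow> seq \<Rightarrow> seq \<Rightarrow> real" where
  "d_theta \<theta> \<omega> \<omega>' = (case separation \<omega> \<omega>' of enat n \<Rightarrow> \<theta> ^ n | \<infinity> \<Rightarrow> 0)"

definition F_theta :: "real \<Rightarrow> (seq \<Rightarrow> complex) set" where
  "F_theta \<theta> = {f. bounded (f ` Omega_star) \<and>
     (\<exists>K. \<forall>\<omega>\<in>Omega_star. \<forall>\<omega>'\<in>Omega_star. cmod (f \<omega> - f \<omega>') \<le> K * d_theta \<theta> \<omega> \<omega>')}"

definition phi :: "(seq \<Rightarrow> real) \<Rightarrow> seq \<Rightarrow> real" where
  "phi V \<omega> = exp (V \<omega>)"

definition psi :: "(seq \<Rightarrow> real) \<Rightarrow> seq \<Rightarrow> real" where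
  "psi V \<omega> = exp (W V \<omega>)"

definition transfer0 :: "(seq \<Rightarrow> real) \<Rightarrow> (seq \<Rightarrow> complex) \<Rightarrow> seq \<Rightarrow> complex" where
  "transfer0 V f \<omega> = of_real (phi V (prefix False \<omega>)) * f (prefix False \<omega>)"

definition transfer1 :: "(seq \<Rightarrow> real) \<Rightarrow> (seq \<Rightarrow> complex) \<Rightarrow> seq \<Rightarrow> complex" where
  "transfer1 V f \<omega> = of_real (phi V (prefix True \<omega>)) * f (prefix True \<omega>)"

definition transfer :: "(seq \<Rightarrow> real) \<Rightarrow> (seq \<Rightarrow> complex) \<Rightarrow> seq \<Rightarrow> complex" where
  "transfer V f \<omega> = transfer0 V f \<omega> + transfer1 V f \<omega>"

definition M_term ::
    "(seq \<Rightarrow> real) \<Rightarrow> complex \<Rightarrow> (seq \<Rightarrow> complex) \<Rightarrow> seq \<Rightarrow> nat \<Rightarrow> complex" where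
  "M_term V z f \<omega> k =
     (let \<eta> = (prefix False ^^ (k - 1)) (prefix True \<omega>)
      in z ^ k * of_real (psi V \<eta>) * f \<eta>)"

definition M :: "(seq \<Rightarrow> real) \<Rightarrow> complex \<Rightarrow> (seq \<Rightarrow> complex) \<Rightarrow> seq \<Rightarrow> complex" where
  "M V z f \<omega> = (\<Sum>k. M_term V z f \<omega> (Suc k))"

end

theory Submission
  imports Defs
begin

text \<open>Since \<open>\<M>\<^sub>z = \<Sum>\<^sub>k z\<^sup>k \<L>\<^sub>1 \<L>\<^sub>0\<^sup>k\<^sup>-\<^sup>1\<close>, the series for \<open>\<M>\<^sub>z (1 - z \<L>\<^sub>0) f\<close> telescopes at each point to
  \<open>z \<L>\<^sub>1 f\<close> minus the limit of \<open>z\<^sup>n\<^sup>+\<^sup>1 \<L>\<^sub>1 \<L>\<^sub>0\<^sup>n f\<close>. This limit vanishes: for \<open>\<bar>z\<bar> < 1\<close> because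
  \<open>\<L>\<^sub>0\<^sup>n f\<close> grows at most linearly in \<open>n\<close>, its increments being the bounded functions
  \<open>\<L>\<^sub>0\<^sup>n (1 - \<L>\<^sub>0) f\<close>, and for \<open>\<bar>z\<bar> = 1\<close> by the assumption on \<open>\<L>\<^sub>0\<^sup>n f\<close>.\<close>

text \<open>Turns the index set of \<open>W\<close> into the positions preceded by zeros only, so
  that later proofs avoid \<open>enat\<close> arithmetic.\<close>

lemma less_tau_iff: "enat k < tau \<omega> \<longleftrightarrow> (\<forall>i<k. \<not> \<omega> i)"
proof (cases k)
  case 0
  then show ?thesis
    by (simp add: tau_def plus_1_eSuc zero_enat_def[symmetric])
next
  case (Suc j)
  \<comment> \<open>As \<open>enat j\<close> is finite, strictness is a successor bound even for
    infinite \<open>x\<close>; unlike \<open><\<close>, the bound \<open>\<le>\<close> passes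
    through an infimum.\<close>
  have step: "enat j < x \<longleftrightarrow> eSuc (enat j) \<le> x" for x
    by (cases x) (auto simp: eSuc_enat Suc_le_eq)
  have "enat k < tau \<omega> \<longleftrightarrow> enat j < (INF i\<in>{i. \<omega> i}. enat i)"
    by (simp add: tau_def plus_1_eSuc Suc eSuc_enat[symmetric])
  also have "\<dots> \<longleftrightarrow> eSuc (enat j) \<le> (INF i\<in>{i. \<omega> i}. enat i)"
    by (rule step)
  also have "\<dots> \<longleftrightarrow> (\<forall>i<k. \<not> \<omega> i)"
    unfolding le_INF_iff eSuc_enat Suc by (auto simp: not_le[symmetric])
  finally show ?thesis .
qed

lemma shift_prefix [simp]: "shift (prefix b \<omega>) = \<omega>"
  by (simp add: shift_def prefix_def)

lemma prefix_0 [simp]: "prefix b \<omega> 0 = b"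
  and prefix_Suc [simp]: "prefix b \<omega> (Suc i) = \<omega> i"
  by (simp_all add: prefix_def)

lemma prefix_in_Omega_star:
  assumes "\<omega> \<in> Omega_star"
  shows "prefix b \<omega> \<in> Omega_star"
proof -
  have "infinite (Suc ` {i. \<omega> i})"
    using assms by (simp add: Omega_star_def finite_image_iff)
  moreover have "Suc ` {i. \<omega> i} \<subseteq> {i. prefix b \<omega> i}"
    by auto
  ultimately show ?thesis
    unfolding Omega_star_def using finite_subset by blast
qed

lemma W_prefix_True: "W V (prefix True \<omega>) = V (prefix True \<omega>)"
proof -
  have "{k. \<forall>i<k. \<not> prefix True \<omega> i} = {0}"
    by (auto simp: gr0_conv_Suc split: nat.splits)
  then show ?thesis
    by (simp add: W_def less_tau_iff)
qed

text \<open>A prepended 0 delays the first 1 by one step, which adds one term to the orbit sum. A 1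
  somewhere in the sequence keeps the index set finite; over an infinite set the sum would default
  to 0.\<close>

lemma W_prefix_False:
  assumes "\<omega> n"
  shows "W V (prefix False \<omega>) = V (prefix False \<omega>) + W V \<omega>"
proof -
  let ?S = "{k. \<forall>i<k. \<not> \<omega> i}"
  have "?S \<subseteq> {..n}"
    using assms by (auto simp: not_less[symmetric])
  then have fin: "finite ?S"
    by (rule finite_subset) simp
  have "{k. \<forall>i<k. \<not> prefix False \<omega> i} = insert 0 (Suc ` ?S)"
  proof (intro set_eqI)
    fix k
    show "k \<in> {k. \<forall>i<k. \<not> prefix False \<omega> i} \<longleftrightarrow> k \<in> insert 0 (Suc ` ?S)"
      by (cases k) (auto simp: All_less_Suc2)
  qed
  then show ?thesis
    using fin by (simp add: W_def less_tau_iff sum.reindex funpow_swap1)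
qed

lemma psi_prefix_True: "psi V (prefix True \<omega>) = phi V (prefix True \<omega>)"
  by (simp add: psi_def phi_def W_prefix_True)

lemma psi_prefix_False:
  "\<omega> n \<Longrightarrow> psi V (prefix False \<omega>) = phi V (prefix False \<omega>) * psi V \<omega>"
  by (simp add: psi_def phi_def W_prefix_False exp_add)

lemma funpow_prefix_False: "(prefix False ^^ k) \<omega> (n + k) = \<omega> n"
  by (induction k) simp_all

text \<open>Each leading zero contributes to \<open>psi\<close> one factor \<open>phi\<close>,
  exactly the weight of one application of \<open>transfer0\<close>. The induction peels off the
  outermost zero and absorbs its weight into \<open>f\<close>, hence \<open>f\<close> is
  arbitrary.\<close>

lemma psi_mult_funpow_transfer0:
  assumes "\<omega> n"
  shows "of_real (psi V ((prefix False ^^ k) \<omega>)) * f ((prefix False ^^ k) \<omega>) =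
    of_real (psi V \<omega>) * (transfer0 V ^^ k) f \<omega>"
proof (induction k arbitrary: f)
  case (Suc k)
  let ?\<eta> = "(prefix False ^^ k) \<omega>"
  have "psi V (prefix False ?\<eta>) = phi V (prefix False ?\<eta>) * psi V ?\<eta>"
    using assms by (intro psi_prefix_False[of _ "n + k"]) (simp add: funpow_prefix_False)
  then have "of_real (psi V (prefix False ?\<eta>)) * f (prefix False ?\<eta>) =
      of_real (psi V ?\<eta>) * transfer0 V f ?\<eta>"
    by (simp add: transfer0_def mult_ac)
  also have "\<dots> = of_real (psi V \<omega>) * (transfer0 V ^^ k) (transfer0 V f) \<omega>"
    by (rule Suc.IH)
  finally show ?case
    by (simp add: funpow_swap1)
qed simp

text \<open>Reconciles the two formulas for the terms of \<open>M\<close>: by \<open>psi\<close>,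
  and by iterated transfer operators.\<close>

lemma M_term_Suc:
  "M_term V z f \<omega> (Suc k) = z ^ Suc k * transfer1 V ((transfer0 V ^^ k) f) \<omega>"
  using psi_mult_funpow_transfer0[of "prefix True \<omega>" 0 V k f]
  by (simp add: M_term_def Let_def transfer1_def psi_prefix_True mult.assoc)

lemma funpow_transfer0_diff:
  "(transfer0 V ^^ k) (\<lambda>\<omega>. f \<omega> - c * g \<omega>) \<omega> =
    (transfer0 V ^^ k) f \<omega> - c * (transfer0 V ^^ k) g \<omega>"
  by (induction k arbitrary: \<omega>) (simp_all add: transfer0_def right_diff_distrib mult.left_commute)

text \<open>The weights \<open>exp (V \<eta>)\<close> are at most 1, so \<open>transfer0\<close> is
  a contraction in the sup norm.\<close>

lemma norm_funpow_transfer0_le: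
  assumes "\<And>\<omega>. V \<omega> \<le> 0" and "\<And>\<omega>. \<omega> \<in> Omega_star \<Longrightarrow> cmod (f \<omega>) \<le> B"
    and "\<omega> \<in> Omega_star"
  shows "cmod ((transfer0 V ^^ k) f \<omega>) \<le> B"
  using assms(3)
proof (induction k arbitrary: \<omega>)
  case (Suc k)
  let ?\<eta> = "prefix False \<omega>"
  have "cmod ((transfer0 V ^^ Suc k) f \<omega>) = exp (V ?\<eta>) * cmod ((transfer0 V ^^ k) f ?\<eta>)"
    by (simp add: transfer0_def phi_def norm_mult)
  also have "\<dots> \<le> 1 * cmod ((transfer0 V ^^ k) f ?\<eta>)"
    using assms(1) by (intro mult_right_mono) auto
  also have "\<dots> \<le> B"
    using Suc by (simp add: prefix_in_Omega_star)
  finally show ?case .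
qed (use assms(2) in simp)

text \<open>Pointwise, since \<open>f\<close> itself may be unbounded on
  \<open>Omega_star\<close>.\<close>

lemma norm_funpow_transfer0_linear_growth:
  assumes "\<And>\<omega>. V \<omega> \<le> 0"
    and "\<And>\<omega>. \<omega> \<in> Omega_star \<Longrightarrow> cmod (f \<omega> - transfer0 V f \<omega>) \<le> B"
    and "\<omega> \<in> Omega_star"
  shows "cmod ((transfer0 V ^^ n) f \<omega>) \<le> cmod (f \<omega>) + real n * B"
proof (induction n)
  case (Suc n)
  let ?a = "\<lambda>n. (transfer0 V ^^ n) f \<omega>"
  have "cmod (?a n - ?a (Suc n)) \<le> B"
    using norm_funpow_transfer0_le[where V = V and f = "\<lambda>\<omega>. f \<omega> - transfer0 V f \<omega>", OF assms, of n]
      funpow_transfer0_diff[of n V f 1 "transfer0 V f" \<omega>]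
    by (simp add: funpow_swap1)
  moreover have "cmod (?a (Suc n)) \<le> cmod (?a n) + cmod (?a n - ?a (Suc n))"
    by (metis norm_minus_commute norm_triangle_sub)
  ultimately show ?case
    using Suc by (simp add: algebra_simps)
qed simp

lemma power_mult_tendsto_zero_of_linear_growth:
  fixes z :: complex
  assumes "cmod z < 1" and "\<And>n. cmod (a n) \<le> C + real n * B"
  shows "(\<lambda>n. z ^ n * a n) \<longlonglongrightarrow> 0"
proof (rule Lim_null_comparison)
  show "\<forall>\<^sub>F n in sequentially. cmod (z ^ n * a n) \<le>
      C * cmod z ^ n + B * (real n * cmod z ^ n)"
    using mult_left_mono[OF assms(2), of "cmod z ^ _"]
    by (auto intro!: always_eventually simp: norm_mult norm_power algebra_simps)
  have "(\<lambda>n. C * cmod z ^ n + B * (real n * cmod z ^ n)) \<longlonglongrightarrow> C * 0 + B * 0"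
    using assms(1) by (intro tendsto_intros LIMSEQ_power_zero powser_times_n_limit_0) simp_all
  then show "(\<lambda>n. C * cmod z ^ n + B * (real n * cmod z ^ n)) \<longlonglongrightarrow> 0"
    by simp
qed

lemma M_term_sums:
  assumes "(\<lambda>n. z ^ n * (transfer0 V ^^ n) f (prefix True \<omega>)) \<longlonglongrightarrow> 0"
  shows "(\<lambda>k. M_term V z (\<lambda>\<omega>. f \<omega> - z * transfer0 V f \<omega>) \<omega> (Suc k)) sums
    (z * transfer1 V f \<omega>)"
proof -
  \<comment> \<open>\<open>transfer1\<close> reads its argument only at
    \<open>prefix True \<omega>\<close>; its weight and one factor \<open>z\<close> come out of
    every term.\<close>
  let ?a = "\<lambda>n. z ^ n * (transfer0 V ^^ n) f (prefix True \<omega>)"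
  have "(\<lambda>k. ?a k - ?a (Suc k)) sums (?a 0 - 0)"
    by (rule telescope_sums'[OF assms])
  then have "(\<lambda>k. z * of_real (phi V (prefix True \<omega>)) * (?a k - ?a (Suc k))) sums
      (z * of_real (phi V (prefix True \<omega>)) * (?a 0 - 0))"
    by (rule sums_mult)
  moreover have "M_term V z (\<lambda>\<omega>. f \<omega> - z * transfer0 V f \<omega>) \<omega> (Suc k) =
      z * of_real (phi V (prefix True \<omega>)) * (?a k - ?a (Suc k))" for k
    by (simp add: M_term_Suc transfer1_def funpow_transfer0_diff funpow_swap1 algebra_simps)
  ultimately show ?thesis
    by (simp add: transfer1_def mult.assoc)
qed

text \<open>Decay on the unit circle is essential: \<open>transfer0\<close> fixes
  \<open>1 / psi V\<close> on \<open>Omega_star\<close>, so for this \<open>f\<close> and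
  \<open>z = 1\<close> the left side is 0, while the right side is -1.\<close>

theorem proposition2:
  fixes V :: "seq \<Rightarrow> real" and C1 C2 C3 \<theta> :: real and z :: complex and f :: "seq \<Rightarrow> complex"
  assumes "admissible_potential V C1 C2 C3 \<theta>"
    and "cmod z \<le> 1"
    and "(\<lambda>\<omega>. f \<omega> - transfer0 V f \<omega>) \<in> F_theta \<theta>"
    and "cmod z = 1 \<Longrightarrow> \<forall>\<omega>\<in>Omega_star. (\<lambda>n. (transfer0 V ^^ n) f \<omega>) \<longlonglongrightarrow> 0"
  shows "let g = (\<lambda>\<omega>. f \<omega> - z * transfer0 V f \<omega>) in
           \<forall>\<omega>\<in>Omega_star. summable (\<lambda>k. M_term V z g \<omega> (Suc k)) \<and>
             g \<omega> - M V z g \<omega> = f \<omega> - z * transfer V f \<omega>"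
proof -
  have V: "V \<omega> \<le> 0" for \<omega>
    using assms(1) by (simp add: admissible_potential_def)
  obtain B where B: "\<And>\<omega>. \<omega> \<in> Omega_star \<Longrightarrow> cmod (f \<omega> - transfer0 V f \<omega>) \<le> B"
    using assms(3) by (auto simp: F_theta_def bounded_iff)
  have lim: "(\<lambda>n. z ^ n * (transfer0 V ^^ n) f \<omega>) \<longlonglongrightarrow> 0" if \<omega>: "\<omega> \<in> Omega_star" for \<omega>
  proof (cases "cmod z = 1")
    case True
    \<comment> \<open>Powers of \<open>z\<close> may rotate without converging, but they leave norms
      unchanged.\<close>
    then have "(\<lambda>n. cmod ((transfer0 V ^^ n) f \<omega>)) \<longlonglongrightarrow> 0"
      using assms(4) \<omega> by (simp add: tendsto_norm_zero)
    with True have "(\<lambda>n. cmod (z ^ n * (transfer0 V ^^ n) f \<omega>)) \<longlonglongrightarrow> 0"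
      by (simp add: norm_mult norm_power)
    then show ?thesis
      by (rule tendsto_norm_zero_cancel)
  next
    case False
    with assms(2) have "cmod z < 1"
      by simp
    then show ?thesis
      using norm_funpow_transfer0_linear_growth[OF V B \<omega>]
      by (rule power_mult_tendsto_zero_of_linear_growth)
  qed
  show ?thesis
    unfolding Let_def
  proof (intro ballI conjI)
    fix \<omega>
    assume "\<omega> \<in> Omega_star"
    then have sums: "(\<lambda>k. M_term V z (\<lambda>\<omega>. f \<omega> - z * transfer0 V f \<omega>) \<omega> (Suc k)) sums
        (z * transfer1 V f \<omega>)"
      by (intro M_term_sums lim prefix_in_Omega_star)
    then show "summable (\<lambda>k. M_term V z (\<lambda>\<omega>. f \<omega> - z * transfer0 V f \<omega>) \<omega> (Suc k))"
      by (rule sums_summable)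
    show "f \<omega> - z * transfer0 V f \<omega> - M V z (\<lambda>\<omega>. f \<omega> - z * transfer0 V f \<omega>) \<omega> =
        f \<omega> - z * transfer V f \<omega>"
      using sums_unique[OF sums] by (simp add: M_def transfer_def algebra_simps)
  qed
qed

end
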